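(* Let $t,k,v$ be integers with $0\le t\le k\le v-t$. Then: (i) the Smith normal form of $W_{t\underline{k}}(v)$ is $(I\mid O)$, where $I$ is the identity matrix of order $\binom{v}{t}$; consequently, for every prime $p$, $W_{t\underline{k}}(v)$ has rank $\binom{v}{t}$ over $\mathbb{F}_p$; (ii) for every positive integer $\lambda$ and every real vector $\mathbf{x}$ indexed by the $k$-subsets of $[v]$, one has $W_{t\underline{k}}(v)\mathbf{x}=\lambda\mathbf{1}$ if and only if $\mathbf{y}=W_{k\underline{k}}(v)D_{t\underline{k}}^{-1}\mathbf{x}$ satisfies $W_{tk}(v)\mathbf{y}=\lambda\mathbf{1}$, where $\mathbf{1}$ is the all-ones vector.
   Context: For a positive integer $v$, $[v]=\{1,\dots,v\}$. $W_{tk}(v)$ is the $\binom{v}{t}\times\binom{v}{k}$ $0,1$-matrix with rows indexed by $t$-subsets $T$, columns by $k$-subsets $K$ of $[v]$, and $(T,K)$ entry $1$ iff $T\subseteq K$. For a finite set $F=\{a_1<\dots<a_m\}$ of positive integers define $b_i=\max\big([a_i]\setminus(F\cup\{b_1,\dots,b_{i-1}\})\big)$ for $i=1,\dots,m$, where $\max\emptyset$ is a special symbol $\mathfrak{j}$ (ignored when it appears among $b_1,\dots,b_{i-1}$). $F$ is full-rank if $b_i\neq\mathfrak{j}$ for all $i$. If $F$ is not full-rank, let $i$ be the largest index with $b_i=\mathfrak{j}$ and $F^-=F\setminus\{a_i\}$. $\overline{F}$ is the full-rank set obtained from $F$ by applying $F\mapsto F^-$ repeatedly until a full-rank set is reached.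 For $K\subseteq[v]$ put $\underline{K}=[v]\setminus\overline{[v]\setminus K}$. For $0\le t\le k\le v$, $W_{t\underline{k}}(v)$ is the $\binom{v}{t}\times\binom{v}{k}$ $0,1$-matrix with rows indexed by $t$-subsets $T$, columns by $k$-subsets $K$ of $[v]$, and $(T,K)$ entry $1$ iff $T\subseteq\underline{K}$ (so $W_{k\underline{k}}(v)$ is the case $t=k$). $D_{t\underline{k}}$ is the $\binom{v}{k}\times\binom{v}{k}$ diagonal matrix indexed by $k$-subsets $K$ with $(K,K)$ entry $\binom{|\underline{K}|-t}{k-t}$. The Smith normal form of an integer matrix $A$ is $(D\mid O)$ with $D=\mathrm{diag}(d_1,\dots,d_r)$, $d_i>0$, $d_1\mid\cdots\mid d_r$, and $UAV=(D\mid O)$ for unimodular $U,V$. *)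

theory Defs
  imports
    "Jordan_Normal_Form.Gauss_Jordan_Elimination"
    "Jordan_Normal_Form.DL_Rank"
    "Berlekamp_Zassenhaus.Finite_Field"
begin

definition ksubsets :: "nat \<Rightarrow> nat \<Rightarrow> nat set set" where
  "ksubsets v k = {K. K \<subseteq> {1..v} \<and> card K = k}"

(* The elements a_1 < ... < a_m of F are indexed from 0 here, so the i-th element is a_(i+1). *)
definition nth_elem :: "nat set \<Rightarrow> nat \<Rightarrow> nat" where
  "nth_elem F i = sorted_list_of_set F ! i"

(* "b_elem F i" is b_(i+1), with None for the special symbol j; the previous values that are
   None contribute the empty set to the union and are thus ignored. *)
function b_elem :: "nat set \<Rightarrow> nat \<Rightarrow> nat option" where
  "b_elem F i =
     (let S = {1..nth_elem F i} - (F \<union> (\<Union>j\<in>{..<i}. set_option (b_elem F j)))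
      in if S = {} then None else Some (Max S))"
  by pat_completeness auto
termination
  by (relation "measure snd") auto

declare b_elem.simps [simp del]

definition full_rank :: "nat set \<Rightarrow> bool" where
  "full_rank F \<longleftrightarrow> (\<forall>i<card F. b_elem F i \<noteq> None)"

(* F^-; only meaningful when F is not full-rank. *)
definition remove_bad :: "nat set \<Rightarrow> nat set" where
  "remove_bad F = F - {nth_elem F (Max {i. i < card F \<and> b_elem F i = None})}"

lemma card_remove_bad:
  assumes "\<not> full_rank F"
  shows "card (remove_bad F) < card F"
proof -
  let ?I = "{i. i < card F \<and> b_elem F i = None}"
  have fin: "finite ?I" by simp
  have ne: "?I \<noteq> {}" using assms by (auto simp: full_rank_def)
  have lt: "Max ?I < card F" using Max_in[OF fin ne] by simp
  then have "finite F" using card.infinite by fastforce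
  then have "nth_elem F (Max ?I) \<in> F"
    using lt nth_mem[of "Max ?I" "sorted_list_of_set F"]
    by (simp add: nth_elem_def)
  with \<open>finite F\<close> show ?thesis
    by (simp add: remove_bad_def card_gt_0_iff card_Diff1_less del: card_Diff_insert)
qed

function full_rank_part :: "nat set \<Rightarrow> nat set" where
  "full_rank_part F = (if full_rank F then F else full_rank_part (remove_bad F))"
  by pat_completeness auto
termination
  by (relation "measure card") (auto simp: card_remove_bad)

declare full_rank_part.simps [simp del]

definition under :: "nat \<Rightarrow> nat set \<Rightarrow> nat set" where
  "under v K = {1..v} - full_rank_part ({1..v} - K)"

(* Matrices indexed by sets of subsets are represented relative to enumerations Ts of the row
   index set and Ks of the column index set. *)

definition W_mat :: "nat set list \<Rightarrow> nat set list \<Rightarrow> 'a::zero_neq_one mat" where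
  "W_mat Ts Ks = mat (length Ts) (length Ks) (\<lambda>(i, j). if Ts ! i \<subseteq> Ks ! j then 1 else 0)"

definition W_under_mat :: "nat \<Rightarrow> nat set list \<Rightarrow> nat set list \<Rightarrow> 'a::zero_neq_one mat" where
  "W_under_mat v Ts Ks =
     mat (length Ts) (length Ks) (\<lambda>(i, j). if Ts ! i \<subseteq> under v (Ks ! j) then 1 else 0)"

definition D_under_mat :: "nat \<Rightarrow> nat \<Rightarrow> nat \<Rightarrow> nat set list \<Rightarrow> 'a::semiring_1 mat" where
  "D_under_mat v t k Ks =
     mat_diag (length Ks) (\<lambda>j. of_nat ((card (under v (Ks ! j)) - t) choose (k - t)))"

definition unimodular :: "int mat \<Rightarrow> bool" where
  "unimodular U \<longleftrightarrow> square_mat U \<and> det U \<in> {1, - 1}"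

(* The block matrix (A | B). *)
definition append_cols :: "'a::zero mat \<Rightarrow> 'a mat \<Rightarrow> 'a mat" where
  "append_cols A B = four_block_mat A B (0\<^sub>m 0 (dim_col A)) (0\<^sub>m 0 (dim_col B))"

(* S is the Smith normal form of A. The form (D | O) has no zero rows, so only matrices
   of full row rank have one in this sense. *)
definition is_smith_normal_form :: "int mat \<Rightarrow> int mat \<Rightarrow> bool" where
  "is_smith_normal_form A S \<longleftrightarrow>
     (\<exists>r c d. S = append_cols (mat_diag r d) (0\<^sub>m r c) \<and>
        (\<forall>i<r. 0 < d i) \<and> (\<forall>i. Suc i < r \<longrightarrow> d i dvd d (Suc i))) \<and>
     (\<exists>U V. unimodular U \<and> unimodular V \<and>
        U \<in> carrier_mat (dim_row A) (dim_row A) \<and> V \<in> carrier_mat (dim_col A) (dim_col A) \<and>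
        U * A * V = S)"

end

theory Submission
  imports Defs
begin

text \<open>
  Put \<open>x - 2 |F \<inter> [x]|\<close> for the excess of \<open>F\<close> at \<open>x\<close>. The
  greedy matching fails at \<open>a \<in> F\<close> exactly when the excess takes a strict new minimum at
  \<open>a\<close>, so \<open>F\<^sup>-\<close> removes the last record. In particular sets of nowhere
  negative excess (ballot sets) are full-rank, and every ballot set \<open>B\<close> with
  \<open>|B| \<le> t\<close> is the full-rank part of some \<open>[v] - K\<close>: insert, repeatedly, the point
  following the last minimum of the excess. The column of such a \<open>K\<close> is the indicator of the
  \<open>t\<close>-subsets disjoint from \<open>B\<close>. There are \<open>v choose t\<close> such ballot sets, and
  by induction on \<open>v\<close> their columns span the integer lattice; so they form a unimodular square
  block, which gives the Smith form and the rank modulo \<open>p\<close>. The second part is the identity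
  \<open>W\<^bsub>tk\<^esub> W\<^bsub>kk\<^esub>' = W\<^bsub>tk\<^esub>' D\<close>, with a prime for the
  underlined index: its entries count the \<open>k\<close>-sets between \<open>T\<close> and \<open>under v K\<close>.
\<close>

section \<open>Excess of a set, and failures of the greedy matching as records\<close>

text \<open>This is the position after \<open>x\<close> steps of a walk that goes down at members of
  \<open>F\<close> and up at non-members. It is integer-valued because its negative values are what
  matters.\<close>

definition excess :: "nat set \<Rightarrow> nat \<Rightarrow> int" where
  "excess F x = int x - 2 * int (card (F \<inter> {1..x}))"

lemma excess_0 [simp]: "excess F 0 = 0"
  by (simp add: excess_def)

text \<open>Turns an injection between the members and the non-members of an interval into an
  inequality between excess values; both directions of the record criterion are obtained this
  way.\<close>

lemma excess_diff:
  assumes "r \<le> a"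
  shows "excess F a - excess F r = int (card ({r<..a} - F)) - int (card ({r<..a} \<inter> F))"
proof -
  have "F \<inter> {1..a} = (F \<inter> {1..r}) \<union> ({r<..a} \<inter> F)" using assms by auto
  then have 1: "card (F \<inter> {1..a}) = card (F \<inter> {1..r}) + card ({r<..a} \<inter> F)"
    by (simp only:, intro card_Un_disjoint) auto
  have "card {r<..a} = card (({r<..a} - F) \<union> ({r<..a} \<inter> F))" by (rule arg_cong[where f=card]) auto
  also have "\<dots> = card ({r<..a} - F) + card ({r<..a} \<inter> F)" by (intro card_Un_disjoint) auto
  finally have "a - r = card ({r<..a} - F) + card ({r<..a} \<inter> F)" by simp
  with 1 assms show ?thesis by (simp add: excess_def)
qed

lemma nth_elem_mem: "finite F \<Longrightarrow> i < card F \<Longrightarrow> nth_elem F i \<in> F"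
  using nth_mem[of i "sorted_list_of_set F"] by (simp add: nth_elem_def)

lemma nth_elem_surj:
  assumes "finite F" "a \<in> F"
  obtains i where "i < card F" "a = nth_elem F i"
  using assms by (metis in_set_conv_nth nth_elem_def set_sorted_list_of_set length_sorted_list_of_set)

lemma nth_elem_less_iff:
  assumes "finite F" "i < card F" "j < card F"
  shows "nth_elem F i < nth_elem F j \<longleftrightarrow> i < j"
proof -
  have "sorted_wrt (<) (sorted_list_of_set F)" by simp
  then have *: "nth_elem F i < nth_elem F j" if "i < j" "j < card F" for i j
    using that by (auto simp: sorted_wrt_iff_nth_less nth_elem_def)
  show ?thesis using *[of i j] *[of j i] assms by (cases i j rule: linorder_cases) auto
qed

lemma nth_elem_eq_iff:
  assumes "finite F" "i < card F" "j < card F"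
  shows "nth_elem F i = nth_elem F j \<longleftrightarrow> i = j"
  using nth_elem_less_iff[OF assms] nth_elem_less_iff[OF assms(1,3,2)] by (cases i j rule: linorder_cases) auto

lemma b_elem_SomeD:
  assumes "b_elem F i = Some b"
  shows "1 \<le> b" "b \<le> nth_elem F i" "b \<notin> F" "j < i \<Longrightarrow> b_elem F j \<noteq> Some b"
    "\<lbrakk>1 \<le> y; y \<le> nth_elem F i; y \<notin> F; \<And>j. j < i \<Longrightarrow> b_elem F j \<noteq> Some y\<rbrakk> \<Longrightarrow> y \<le> b"
proof -
  let ?S = "{1..nth_elem F i} - (F \<union> (\<Union>j\<in>{..<i}. set_option (b_elem F j)))"
  have ne: "?S \<noteq> {}" and b: "b = Max ?S"
    using assms by (simp_all add: b_elem.simps[of F i] Let_def split: if_splits)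
  have "b \<in> ?S" unfolding b by (rule Max_in[OF _ ne]) simp
  then show "1 \<le> b" "b \<le> nth_elem F i" "b \<notin> F" "j < i \<Longrightarrow> b_elem F j \<noteq> Some b"
    by auto
  assume y: "1 \<le> y" "y \<le> nth_elem F i" "y \<notin> F" "\<And>j. j < i \<Longrightarrow> b_elem F j \<noteq> Some y"
  then have "y \<in> ?S" by auto
  then show "y \<le> b" unfolding b by (intro Max_ge) auto
qed

lemma b_elem_NoneD:
  assumes "b_elem F i = None" "1 \<le> y" "y \<le> nth_elem F i" "y \<notin> F"
  obtains j where "j < i" "b_elem F j = Some y"
proof -
  let ?S = "{1..nth_elem F i} - (F \<union> (\<Union>j\<in>{..<i}. set_option (b_elem F j)))"
  have "?S = {}" using assms(1) by (simp add: b_elem.simps[of F i] Let_def split: if_splits)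
  then show thesis using assms(2-) that by fastforce
qed

text \<open>If the matching fails at \<open>a\<close>, every non-member \<open>y\<close> in
  \<open>(r, a]\<close> was consumed by an earlier element. That element is at least
  \<open>y\<close> and below \<open>a\<close>, so the non-members of the interval inject into its
  members other than \<open>a\<close>.\<close>

lemma b_elem_None_imp_record:
  assumes fin: "finite F" and i: "i < card F" and None: "b_elem F i = None" and r: "r < nth_elem F i"
  shows "excess F (nth_elem F i) < excess F r"
proof -
  let ?a = "nth_elem F i"
  define g where "g y = (SOME j. j < i \<and> b_elem F j = Some y)" for y
  have g: "g y < i \<and> b_elem F (g y) = Some y" if "y \<in> {r<..?a} - F" for y
  proof -
    have "\<exists>j. j < i \<and> b_elem F j = Some y"
      using b_elem_NoneD[OF None, of y] that by auto
    then show ?thesis unfolding g_def by (rule someI_ex)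
  qed
  have "card ({r<..?a} - F) \<le> card ({r<..?a} \<inter> F - {?a})"
  proof (rule card_inj_on_le[where f = "\<lambda>y. nth_elem F (g y)"])
    show "inj_on (\<lambda>y. nth_elem F (g y)) ({r<..?a} - F)"
    proof (rule inj_onI)
      fix x y assume x: "x \<in> {r<..?a} - F" and y: "y \<in> {r<..?a} - F"
        and eq: "nth_elem F (g x) = nth_elem F (g y)"
      have "g x < card F" "g y < card F" using g[OF x] g[OF y] i by simp_all
      from nth_elem_eq_iff[OF fin this] eq have "g x = g y" by simp
      moreover have "b_elem F (g x) = Some x" "b_elem F (g y) = Some y" using g[OF x] g[OF y] by blast+
      ultimately show "x = y" by (metis option.inject)
    qed
    show "(\<lambda>y. nth_elem F (g y)) ` ({r<..?a} - F) \<subseteq> {r<..?a} \<inter> F - {?a}"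
    proof clarify
      fix y assume "y \<in> {r<..?a}" "y \<notin> F"
      then have y: "y \<in> {r<..?a} - F" by simp
      have gy: "g y < i" "b_elem F (g y) = Some y" using g[OF y] by auto
      have "nth_elem F (g y) < ?a" using nth_elem_less_iff[OF fin, of "g y" i] gy i by simp
      moreover have "y \<le> nth_elem F (g y)" by (rule b_elem_SomeD(2)[OF gy(2)])
      moreover have "nth_elem F (g y) \<in> F" using gy i by (intro nth_elem_mem fin) auto
      ultimately show "nth_elem F (g y) \<in> {r<..?a} \<inter> F - {?a}" using y by auto
    qed
  qed simp
  \<comment> \<open>The element \<open>?a\<close> itself is outside the image of the injection,
    which makes the inequality strict.\<close>
  also have "\<dots> < card ({r<..?a} \<inter> F)"
    using nth_elem_mem[OF fin i] r by (intro card_Diff1_less) simp_all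
  finally have "card ({r<..?a} - F) < card ({r<..?a} \<inter> F)" .
  moreover have "r \<le> ?a" using r by (rule less_imp_le)
  ultimately show ?thesis using excess_diff[of r ?a F] by linarith
qed

text \<open>While \<open>b\<close> is still free, every member in \<open>[b, a]\<close> finds a
  match, and by maximality one that is at least \<open>b\<close>. So the members of
  \<open>[b, a]\<close> inject into its non-members, and position \<open>b - 1\<close> witnesses
  that \<open>a\<close> is not a strict new minimum.\<close>

lemma b_elem_Some_imp_not_record:
  assumes fin: "finite F" and i: "i < card F" and Some: "b_elem F i = Some b"
  shows "excess F (b - 1) \<le> excess F (nth_elem F i)" "b - 1 < nth_elem F i"
proof -
  let ?a = "nth_elem F i"
  note b = b_elem_SomeD[OF Some]
  show lt: "b - 1 < ?a" using b(1,2) by simp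
  define h where "h a = (SOME j. j < card F \<and> a = nth_elem F j)" for a
  have h: "h a < card F \<and> a = nth_elem F (h a)" if "a \<in> F" for a
  proof -
    have "\<exists>j. j < card F \<and> a = nth_elem F j" using nth_elem_surj[OF fin that] by metis
    then show ?thesis unfolding h_def by (rule someI_ex)
  qed
  \<comment> \<open>The half-open interval begins at \<open>b - 1\<close> so that it contains
    \<open>b\<close>; the subtraction is exact because \<open>1 <= b\<close>.\<close>
  let ?I = "{b - 1<..?a}"
  have *: "\<exists>y. b_elem F (h a) = Some y \<and> b \<le> y \<and> y \<le> ?a \<and> y \<notin> F" if a: "a \<in> ?I \<inter> F" for a
  proof -
    have ha: "h a < card F" "a = nth_elem F (h a)" using h a by auto
    have hi: "h a \<le> i"
      using nth_elem_less_iff[OF fin i, of "h a"] ha a by (auto simp: not_less[symmetric])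
    have free: "b_elem F j \<noteq> Some b" if "j < h a" for j using b(4)[of j] that hi by simp
    have ba: "b \<le> nth_elem F (h a)" using a ha b(1) by auto
    show ?thesis
    proof (cases "b_elem F (h a)")
      case None
      from b_elem_NoneD[OF None b(1) ba b(3)] free show ?thesis by metis
    next
      case (Some y)
      from b_elem_SomeD(5)[OF Some b(1) ba b(3) free] b_elem_SomeD(2,3)[OF Some] a ha
      show ?thesis using Some by auto
    qed
  qed
  have "card (?I \<inter> F) \<le> card (?I - F)"
  proof (rule card_inj_on_le[where f = "\<lambda>a. the (b_elem F (h a))"])
    show "inj_on (\<lambda>a. the (b_elem F (h a))) (?I \<inter> F)"
    proof (rule inj_onI)
      fix x y assume x: "x \<in> ?I \<inter> F" and y: "y \<in> ?I \<inter> F"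
        and eq: "the (b_elem F (h x)) = the (b_elem F (h y))"
      obtain z where z: "b_elem F (h x) = Some z" "b_elem F (h y) = Some z"
        using *[OF x] *[OF y] eq by auto
      have "h x = h y" using b_elem_SomeD(4)[OF z(1)] b_elem_SomeD(4)[OF z(2)] z
        by (metis linorder_neqE_nat)
      then show "x = y" using h[of x] h[of y] x y by auto
    qed
    show "(\<lambda>a. the (b_elem F (h a))) ` (?I \<inter> F) \<subseteq> ?I - F"
      using * b(1) by fastforce
  qed simp
  then show "excess F (b - 1) \<le> excess F ?a"
    using excess_diff[OF less_imp_le[OF lt], of F] by linarith
qed

text \<open>Position \<open>r = 0\<close> has excess 0, so a positive record has negative excess.
  The element 0 would be a vacuous record, in agreement with \<open>b_elem\<close>, which has no
  candidate in \<open>{1..0}\<close>.\<close>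

definition records :: "nat set \<Rightarrow> nat set" where
  "records F = {a \<in> F. \<forall>r<a. excess F a < excess F r}"

lemma b_elem_None_iff_record:
  assumes "finite F" "i < card F"
  shows "b_elem F i = None \<longleftrightarrow> nth_elem F i \<in> records F"
proof (cases "b_elem F i")
  case None
  then show ?thesis using b_elem_None_imp_record[OF assms None] nth_elem_mem[OF assms]
    by (simp add: records_def)
next
  case (Some b)
  then show ?thesis using b_elem_Some_imp_not_record[OF assms Some]
    by (auto simp: records_def not_less)
qed

lemma full_rank_iff_no_records:
  assumes "finite F"
  shows "full_rank F \<longleftrightarrow> records F = {}"
proof -
  have "full_rank F \<longleftrightarrow> (\<forall>i<card F. nth_elem F i \<notin> records F)"
    using b_elem_None_iff_record[OF assms] by (simp add: full_rank_def)
  also have "\<dots> \<longleftrightarrow> records F = {}"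
  proof
    assume *: "\<forall>i<card F. nth_elem F i \<notin> records F"
    show "records F = {}"
    proof (rule equals0I)
      fix a assume a: "a \<in> records F"
      then have "a \<in> F" by (simp add: records_def)
      then show False using nth_elem_surj[OF assms] * a by metis
    qed
  qed simp
  finally show ?thesis .
qed

text \<open>Indices and elements are ordered alike, so the largest failing index belongs to the last
  record.\<close>

lemma remove_bad_eq:
  assumes fin: "finite F" and a: "a \<in> records F" and last: "\<And>c. c \<in> records F \<Longrightarrow> c \<le> a"
  shows "remove_bad F = F - {a}"
proof -
  let ?I = "{i. i < card F \<and> b_elem F i = None}"
  obtain i where i: "i < card F" "a = nth_elem F i"
    using nth_elem_surj[OF fin] a by (auto simp: records_def)
  have "Max ?I = i"
  proof (rule Max_eqI)
    fix j assume "j \<in> ?I"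
    then have j: "j < card F" "nth_elem F j \<in> records F"
      using b_elem_None_iff_record[OF fin] by auto
    show "j \<le> i" using last[OF j(2)] nth_elem_less_iff[OF fin i(1) j(1)] i(2)
      by (simp add: not_less[symmetric])
  qed (use b_elem_None_iff_record[OF fin i(1)] i a in auto)
  then show ?thesis by (simp add: remove_bad_def i(2))
qed

lemma full_rank_part_subset:
  "finite F \<Longrightarrow> full_rank_part F \<subseteq> F"
proof (induction F rule: full_rank_part.induct)
  case (1 F)
  have "remove_bad F \<subseteq> F" by (auto simp: remove_bad_def)
  then show ?case using 1 full_rank_part.simps[of F] by (auto dest: finite_subset)
qed

section \<open>Ballot sets as full-rank parts\<close>

lemma excess_insert:
  assumes "a \<notin> F" "1 \<le> a"
  shows "excess (insert a F) x = (if x < a then excess F x else excess F x - 2)"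
  using assms by (auto simp: excess_def Int_insert_left)

lemma excess_Suc:
  "excess F (Suc p) = (if Suc p \<in> F then excess F p - 1 else excess F p + 1)"
proof -
  have "F \<inter> {1..Suc p} = (if Suc p \<in> F then insert (Suc p) (F \<inter> {1..p}) else F \<inter> {1..p})"
    by (auto simp: atLeastAtMostSuc_conv)
  then show ?thesis by (simp add: excess_def)
qed

text \<open>Here \<open>p\<close> is the last minimum of the excess on \<open>[0, v]\<close>, so the
  walk goes up at \<open>Suc p\<close>. Inserting \<open>Suc p\<close> lowers all values from there
  on by 2: \<open>Suc p\<close> becomes a new strict minimum, one lower, while later values,
  formerly above the minimum, do not fall below the new one. So \<open>Suc p\<close> is the last
  record and \<open>remove_bad\<close> undoes the insertion.\<close>

lemma insert_record:
  assumes F: "F \<subseteq> {1..v}" and p: "p < v"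
    and le: "\<And>r. r \<le> p \<Longrightarrow> excess F p \<le> excess F r"
    and gr: "\<And>r. p < r \<Longrightarrow> r \<le> v \<Longrightarrow> excess F p < excess F r"
  shows "Suc p \<notin> F" "remove_bad (insert (Suc p) F) = F" "\<not> full_rank (insert (Suc p) F)"
    "excess (insert (Suc p) F) (Suc p) = excess F p - 1"
    "r \<le> v \<Longrightarrow> excess (insert (Suc p) F) r \<ge> excess F p - 1"
proof -
  let ?F = "insert (Suc p) F"
  show nF: "Suc p \<notin> F" using gr[of "Suc p"] p excess_Suc[of F p] by (auto split: if_splits)
  have ex: "excess ?F x = (if x < Suc p then excess F x else excess F x - 2)" for x
    using excess_insert[OF nF] by simp
  show exp: "excess ?F (Suc p) = excess F p - 1" using ex[of "Suc p"] nF excess_Suc[of F p] by simp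
  show ge: "excess ?F r \<ge> excess F p - 1" if "r \<le> v" for r
    using ex[of r] le[of r] gr[of r] that by (auto split: if_splits)
  have fin: "finite ?F" using F finite_subset by auto
  have rec: "Suc p \<in> records ?F" unfolding records_def using exp ex le by (fastforce simp: less_Suc_eq_le)
  have last: "c \<le> Suc p" if c: "c \<in> records ?F" for c
  proof (rule ccontr)
    assume "\<not> c \<le> Suc p"
    moreover have "c \<le> v" using c F p by (auto simp: records_def)
    moreover have "excess ?F c < excess ?F (Suc p)" if "Suc p < c" using c that by (simp add: records_def)
    ultimately show False using ge[of c] exp by simp
  qed
  show "remove_bad ?F = F" using remove_bad_eq[OF fin rec last] nF by simp
  show "\<not> full_rank ?F" using full_rank_iff_no_records[OF fin] rec by auto
qed

text \<open>All sizes up to \<open>s\<close> are kept together, because it is this union that has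
  \<open>v choose s\<close> members when \<open>2 * s <= v\<close>.\<close>

definition ballots :: "nat \<Rightarrow> nat \<Rightarrow> nat set set" where
  "ballots v s = {B. B \<subseteq> {1..v} \<and> card B \<le> s \<and> (\<forall>x. 2 * card (B \<inter> {1..x}) \<le> x)}"

lemma excess_ballot_nonneg:
  assumes "B \<in> ballots v s"
  shows "0 \<le> excess B x"
proof -
  have "2 * card (B \<inter> {1..x}) \<le> x" using assms by (simp add: ballots_def)
  then show ?thesis unfolding excess_def by linarith
qed

text \<open>Position 0, with excess 0, keeps every member from being a strict new minimum.\<close>

lemma full_rank_ballot:
  assumes "B \<in> ballots v s"
  shows "full_rank B"
proof -
  have nn: "0 \<le> excess B x" for x using excess_ballot_nonneg[OF assms] .
  have "1 \<le> a" if "a \<in> B" for a using assms that by (auto simp: ballots_def)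
  then have "\<exists>r<a. excess B r \<le> excess B a" if "a \<in> B" for a
    using nn[of a] that by (intro exI[of _ 0]) force
  then have "records B = {}" by (force simp: records_def)
  moreover have "finite B" using assms finite_subset by (auto simp: ballots_def)
  ultimately show ?thesis by (simp add: full_rank_iff_no_records)
qed

text \<open>Each of the \<open>n\<close> insertions adds one record on top of \<open>B\<close>. The
  last two conjuncts fix the minimum of the excess at \<open>- int n\<close>; this strengthening
  locates the next insertion point.\<close>

lemma exists_full_rank_part_eq:
  assumes B: "B \<in> ballots v s" and "2 * card B + n \<le> v"
  shows "\<exists>F. F \<subseteq> {1..v} \<and> card F = card B + n \<and> full_rank_part F = B \<and>
    (\<exists>r\<le>v. excess F r = - int n) \<and> (\<forall>r\<le>v. - int n \<le> excess F r)"
  using assms(2)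
proof (induction n)
  case 0
  have "full_rank_part B = B" using full_rank_ballot[OF B] full_rank_part.simps by simp
  moreover have "excess B 0 = 0" "\<forall>r. 0 \<le> excess B r"
    using excess_ballot_nonneg[OF B] by auto
  ultimately show ?case using B by (intro exI[of _ B]) (auto simp: ballots_def)
next
  case (Suc n)
  then obtain F where F: "F \<subseteq> {1..v}" "card F = card B + n" "full_rank_part F = B"
    and r: "\<exists>r\<le>v. excess F r = - int n" and ge: "\<forall>r\<le>v. - int n \<le> excess F r" by auto
  define p where "p = (GREATEST r. r \<le> v \<and> excess F r = - int n)"
  have p: "p \<le> v \<and> excess F p = - int n" unfolding p_def
    by (rule GreatestI_ex_nat[where b = v]) (use r in auto)
  have pmax: "r \<le> p" if "r \<le> v" "excess F r = - int n" for r unfolding p_def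
    by (rule Greatest_le_nat[where b = v]) (use that in auto)
  \<comment> \<open>The length bound makes this at least \<open>1 - int n\<close>, so the last
    minimum lies strictly before \<open>v\<close> and there is room for
    \<open>Suc p\<close>.\<close>
  have "excess F v = int v - 2 * int (card F)"
    using F(1) by (simp add: excess_def Int_absorb2)
  then have "excess F v \<noteq> - int n" using F(2) Suc.prems by simp
  then have pv: "p < v" using p by (cases "p = v") auto
  have le: "excess F p \<le> excess F r" if "r \<le> p" for r using that p ge by auto
  have gr: "excess F p < excess F r" if "p < r" "r \<le> v" for r
    using that p ge pmax[of r] by (metis not_less order_antisym_conv)
  note ins = insert_record[OF F(1) pv le gr]
  let ?F = "insert (Suc p) F"
  have finF: "finite F" using F(1) finite_subset by auto
  have "full_rank_part ?F = B"
    using ins(2,3) F(3) full_rank_part.simps[of ?F] by simp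
  moreover have "card ?F = card B + Suc n" using ins(1) finF F(2) by simp
  moreover have "?F \<subseteq> {1..v}" using F(1) pv by auto
  moreover have "excess ?F (Suc p) = - int (Suc n)" using ins(4) p by simp
  moreover have "- int (Suc n) \<le> excess ?F r" if "r \<le> v" for r using ins(5)[of r] that p by simp
  moreover have "Suc p \<le> v" using pv by simp
  ultimately show ?case by blast
qed

lemma exists_under_eq:
  assumes B: "B \<in> ballots v t" and "t \<le> k" "t + k \<le> v"
  obtains K where "K \<in> ksubsets v k" "full_rank_part ({1..v} - K) = B"
proof -
  have cB: "card B \<le> t" using B by (simp add: ballots_def)
  \<comment> \<open>The number of insertions is chosen so that \<open>F\<close> gets
    \<open>v - k\<close> elements and its complement \<open>k\<close>; the truncated subtractions
    are exact since \<open>card B <= t <= v - k\<close>.\<close>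
  have "2 * card B + (v - k - card B) \<le> v" using cB assms by simp
  from exists_full_rank_part_eq[OF B this]
  obtain F where F: "F \<subseteq> {1..v}" "card F = card B + (v - k - card B)" "full_rank_part F = B"
    by blast
  have eq: "{1..v} - ({1..v} - F) = F" using F(1) by (rule double_diff) simp
  have "card ({1..v} - F) = v - card F"
    using F(1) by (subst card_Diff_subset) (auto intro: finite_subset[OF F(1)])
  also have "\<dots> = k" using F(2) cB assms by simp
  finally have "{1..v} - F \<in> ksubsets v k" by (simp add: ksubsets_def)
  then show thesis using that F(3) eq by metis
qed

section \<open>Counting ballot sets\<close>

lemma finite_ballots [simp]: "finite (ballots v s)"
  by (rule finite_subset[of _ "Pow {1..v}"]) (auto simp: ballots_def)

lemma ballots_card_double_le:
  assumes "B \<in> ballots v s"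
  shows "2 * card B \<le> v"
proof -
  have "B \<inter> {1..v} = B" "2 * card (B \<inter> {1..v}) \<le> v" using assms by (auto simp: ballots_def)
  then show ?thesis by simp
qed

text \<open>A ballot set fills at most half of \<open>[v]\<close>, so size \<open>Suc s\<close> does
  not occur.\<close>

lemma ballots_eq_pred:
  assumes "v < 2 * Suc s"
  shows "ballots v (Suc s) = ballots v s"
proof -
  have "card B \<le> s" if "B \<in> ballots v (Suc s)" for B
    using ballots_card_double_le[OF that] assms by simp
  then show ?thesis by (auto simp: ballots_def)
qed

lemma ballots_0: "ballots v 0 = {{}}"
proof -
  have "B = {}" if "B \<subseteq> {1..v}" "card B = 0" for B :: "nat set"
    using that finite_subset by fastforce
  then show ?thesis by (auto simp: ballots_def)
qed

text \<open>Splits by membership of the last point. The hypothesis on \<open>s\<close> lets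
  \<open>Suc n\<close> be added to any ballot set of size at most \<open>s\<close>: the ballot
  condition can only be endangered from position \<open>Suc n\<close> on, where at most
  \<open>Suc s\<close> members are counted.\<close>

lemma ballots_Suc:
  assumes "2 * Suc s \<le> Suc n"
  shows "ballots (Suc n) (Suc s) = ballots n (Suc s) \<union> insert (Suc n) ` ballots n s"
proof (intro equalityI subsetI)
  fix B assume B: "B \<in> ballots (Suc n) (Suc s)"
  then have finB: "finite B" using finite_subset by (auto simp: ballots_def)
  show "B \<in> ballots n (Suc s) \<union> insert (Suc n) ` ballots n s"
  proof (cases "Suc n \<in> B")
    case False
    then have "B \<in> ballots n (Suc s)" using B by (auto simp: ballots_def atLeastAtMostSuc_conv)
    then show ?thesis ..
  next
    case True
    have "card ((B - {Suc n}) \<inter> {1..x}) \<le> card (B \<inter> {1..x})" for x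
      by (intro card_mono) auto
    moreover have "2 * card (B \<inter> {1..x}) \<le> x" for x using B by (simp add: ballots_def)
    ultimately have "2 * card ((B - {Suc n}) \<inter> {1..x}) \<le> x" for x
      by (meson le_trans mult_le_mono2)
    moreover have "B - {Suc n} \<subseteq> {1..n}" using B by (auto simp: ballots_def atLeastAtMostSuc_conv)
    moreover have "card (B - {Suc n}) \<le> s"
    proof -
      have "card B \<le> Suc s" using B by (simp add: ballots_def)
      then show ?thesis using True finB by (simp add: card_Diff_singleton)
    qed
    ultimately have "B - {Suc n} \<in> ballots n s" by (simp add: ballots_def)
    moreover have "B = insert (Suc n) (B - {Suc n})" using True by auto
    ultimately show ?thesis by blast
  qed
next
  fix B assume "B \<in> ballots n (Suc s) \<union> insert (Suc n) ` ballots n s"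
  then show "B \<in> ballots (Suc n) (Suc s)"
  proof
    assume "B \<in> ballots n (Suc s)"
    then show ?thesis by (auto simp: ballots_def)
  next
    assume "B \<in> insert (Suc n) ` ballots n s"
    then obtain C where C: "C \<in> ballots n s" and B: "B = insert (Suc n) C" by auto
    have Cn: "C \<subseteq> {1..n}" using C by (simp add: ballots_def)
    then have finC: "finite C" using finite_subset by auto
    have "card C \<le> s" using C by (simp add: ballots_def)
    then have cB: "card B \<le> Suc s" using card_insert_le_m1[of "Suc s" C "Suc n"] B by simp
    have "2 * card (B \<inter> {1..x}) \<le> x" for x
    proof (cases "x < Suc n")
      case True
      then have "B \<inter> {1..x} = C \<inter> {1..x}" using B by auto
      then show ?thesis using C by (simp add: ballots_def)
    next
      case False
      have "card (B \<inter> {1..x}) \<le> card B" using finC B by (intro card_mono) auto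
      then show ?thesis using False cB assms by simp
    qed
    moreover have "B \<subseteq> {1..Suc n}" using B Cn by auto
    ultimately show ?thesis using cB by (simp add: ballots_def)
  qed
qed

lemma Suc_notin_ballot: "B \<in> ballots n s \<Longrightarrow> Suc n \<notin> B"
  by (auto simp: ballots_def)

lemma inj_on_insert_ballots: "inj_on (insert (Suc n)) (ballots n s)"
proof (rule inj_onI)
  fix B C assume "B \<in> ballots n s" "C \<in> ballots n s" "insert (Suc n) B = insert (Suc n) C"
  then show "B = C" using Suc_notin_ballot by (metis insert_ident)
qed

lemma sum_ballots_Suc:
  fixes g :: "nat set \<Rightarrow> 'a::comm_monoid_add"
  assumes "2 * Suc s \<le> Suc n"
  shows "sum g (ballots (Suc n) (Suc s)) =
    sum g (ballots n (Suc s)) + (\<Sum>B\<in>ballots n s. g (insert (Suc n) B))"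
proof -
  have "sum g (ballots (Suc n) (Suc s)) = sum g (ballots n (Suc s)) + sum g (insert (Suc n) ` ballots n s)"
    unfolding ballots_Suc[OF assms] using Suc_notin_ballot by (intro sum.union_disjoint) auto
  then show ?thesis by (simp add: sum.reindex[OF inj_on_insert_ballots])
qed

text \<open>The splitting by the last point becomes Pascal's rule.\<close>

lemma card_ballots: "2 * s \<le> v \<Longrightarrow> card (ballots v s) = v choose s"
proof (induction v arbitrary: s)
  case 0
  then show ?case by (simp add: ballots_0)
next
  case (Suc n)
  show ?case
  proof (cases s)
    case 0
    then show ?thesis by (simp add: ballots_0)
  next
    case s: (Suc s')
    have "card (ballots (Suc n) s) = card (ballots n s) + card (ballots n s')"
      using sum_ballots_Suc[of s' n "\<lambda>_. 1::nat"] Suc.prems s by simp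
    also have "card (ballots n s') = n choose s'" using Suc s by simp
    also have "card (ballots n s) = n choose s"
    proof (cases "2 * s \<le> n")
      case True
      then show ?thesis by (rule Suc.IH)
    next
      \<comment> \<open>Here \<open>2 * s = n + 1\<close>: size \<open>s\<close> does not occur in
        \<open>[n]\<close>, and the two binomials are equal by symmetry.\<close>
      case False
      then have "n = s + s'" using Suc.prems s by simp
      then have "n choose s = n choose s'" using binomial_symmetric[of s n] by simp
      then show ?thesis using False s ballots_eq_pred[of n s'] \<open>card (ballots n s') = _\<close> by simp
    qed
    finally show ?thesis using s by simp
  qed
qed

section \<open>Avoidance vectors of ballot sets span\<close>

text \<open>The vector of \<open>B\<close> is the indicator of the sets disjoint from
  \<open>B\<close>; this is the linear combination with coefficients \<open>c\<close>, evaluated at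
  \<open>T\<close>.\<close>

definition avoid_sum :: "nat \<Rightarrow> nat \<Rightarrow> (nat set \<Rightarrow> 'a::comm_ring_1) \<Rightarrow> nat set \<Rightarrow> 'a" where
  "avoid_sum v s c T = (\<Sum>B\<in>ballots v s. if T \<inter> B = {} then c B else 0)"

text \<open>Coefficients \<open>d\<close> go to the ballot sets avoiding \<open>Suc n\<close>, and
  \<open>e\<close> to those containing it. The latter vanish on every \<open>T\<close> with
  \<open>Suc n\<close> in it, so \<open>d\<close> alone must reproduce \<open>f\<close>
  there.\<close>

lemma avoid_sum_combine:
  assumes s: "2 * Suc s \<le> Suc n"
    and f0: "\<And>T. T \<in> ksubsets n (Suc t) \<Longrightarrow> f T = avoid_sum n (Suc s) d T + avoid_sum n s e T"
    and f1: "\<And>T. T \<in> ksubsets n t \<Longrightarrow> f (insert (Suc n) T) = avoid_sum n (Suc s) d T"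
  shows "\<exists>c. \<forall>T\<in>ksubsets (Suc n) (Suc t). f T = avoid_sum (Suc n) (Suc s) c T"
proof (intro exI ballI)
  let ?c = "\<lambda>B. if Suc n \<in> B then e (B - {Suc n}) else d B"
  fix T assume T: "T \<in> ksubsets (Suc n) (Suc t)"
  have split: "avoid_sum (Suc n) (Suc s) ?c T = avoid_sum n (Suc s) d T +
     (if Suc n \<in> T then 0 else avoid_sum n s e T)"
    unfolding avoid_sum_def sum_ballots_Suc[OF s]
    using Suc_notin_ballot by (intro arg_cong2[where f = "(+)"]) (auto intro!: sum.cong)
  have finT: "finite T" using T finite_subset by (auto simp: ksubsets_def)
  show "f T = avoid_sum (Suc n) (Suc s) ?c T"
  proof (cases "Suc n \<in> T")
    case False
    then have "T \<in> ksubsets n (Suc t)" using T by (auto simp: ksubsets_def atLeastAtMostSuc_conv)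
    then show ?thesis using f0 False split by simp
  next
    case True
    let ?T = "T - {Suc n}"
    have "?T \<in> ksubsets n t" using T True finT by (auto simp: ksubsets_def atLeastAtMostSuc_conv)
    then have "f T = avoid_sum n (Suc s) d ?T" using f1[of ?T] True by (simp add: insert_absorb)
    also have "\<dots> = avoid_sum n (Suc s) d T"
      unfolding avoid_sum_def
    proof (rule sum.cong)
      fix B assume "B \<in> ballots n (Suc s)"
      then have "?T \<inter> B = T \<inter> B" using Suc_notin_ballot by blast
      then show "(if ?T \<inter> B = {} then d B else 0) = (if T \<inter> B = {} then d B else 0)" by simp
    qed simp
    finally show ?thesis using split True by simp
  qed
qed

text \<open>Splitting off the point \<open>v\<close> writes a function on \<open>t\<close>-subsets as a pair of functions on the
  \<open>t\<close>- and \<open>(t-1)\<close>-subsets of \<open>[v-1]\<close>; a ballot set \<open>B\<close> avoiding \<open>v\<close> contributes its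
  avoidance vector to both components, and \<open>B \<union> {v}\<close> contributes it to the first one only.\<close>
lemma avoid_sum_spans:
  fixes f :: "nat set \<Rightarrow> 'a::comm_ring_1"
  assumes "t \<le> v"
  shows "\<exists>c. \<forall>T\<in>ksubsets v t. f T = avoid_sum v (min t (v - t)) c T"
  using assms
proof (induction v arbitrary: t f)
  case 0
  then show ?case
    by (intro exI[of _ "\<lambda>_. f {}"]) (auto simp: avoid_sum_def ballots_0 ksubsets_def)
next
  case (Suc n)
  consider "t = 0" | "t = Suc n" | t' where "t = Suc t'" "t' < n"
    using Suc.prems by (cases t) force+
  then show ?case
  proof cases
    case 1
    have "T = {}" if "T \<in> ksubsets (Suc n) 0" for T
      using that finite_subset[of T "{1..Suc n}"] by (auto simp: ksubsets_def)
    then show ?thesis using 1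
      by (intro exI[of _ "\<lambda>_. f {}"]) (auto simp: avoid_sum_def ballots_0)
  next
    case 2
    have "T = {1..Suc n}" if "T \<in> ksubsets (Suc n) (Suc n)" for T
      using that by (intro card_subset_eq) (auto simp: ksubsets_def)
    then show ?thesis using 2
      by (intro exI[of _ "\<lambda>_. f {1..Suc n}"]) (auto simp: avoid_sum_def ballots_0)
  next
    case (3 t')
    define f1 where "f1 T = f (insert (Suc n) T)" for T
    show ?thesis
    proof (cases "2 * t \<le> n")
      case True
      have mins: "min t (Suc n - t) = Suc t'" "min t (n - t) = t" "min t' (n - t') = t'"
        using True 3 by auto
      obtain c0 where c0: "\<And>T. T \<in> ksubsets n t \<Longrightarrow> f T = avoid_sum n t c0 T"
        using Suc.IH[of t f] 3 mins by auto
      \<comment> \<open>\<open>?top\<close> collects the ballot sets of size exactly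
        \<open>t\<close>. Their coefficients are kept from an expansion of \<open>f\<close>, the
        smaller ones are then solved for so as to fit \<open>f1\<close>, and the difference
        \<open>c0 - d\<close> goes to the sets containing \<open>Suc n\<close>.\<close>
      let ?top = "\<lambda>c T. \<Sum>B\<in>ballots n t - ballots n t'. if T \<inter> B = {} then c B else 0"
      obtain d where d: "\<And>T. T \<in> ksubsets n t' \<Longrightarrow> f1 T - ?top c0 T = avoid_sum n t' d T"
        using Suc.IH[of t' "\<lambda>T. f1 T - ?top c0 T"] 3 mins by auto
      have sub: "ballots n t' \<subseteq> ballots n t" using 3 by (auto simp: ballots_def)
      have split: "avoid_sum n t c T = ?top c T + avoid_sum n t' c T"
        for c :: "nat set \<Rightarrow> 'a" and T
        unfolding avoid_sum_def by (rule sum.subset_diff[OF sub]) simp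
      let ?d = "\<lambda>B. if B \<in> ballots n t' then d B else c0 B"
      have top: "?top ?d T = ?top c0 T" for T by (intro sum.cong) auto
      have low: "avoid_sum n t' ?d T = avoid_sum n t' d T" for T
        unfolding avoid_sum_def by (intro sum.cong) auto
      have diff: "avoid_sum n t' (\<lambda>B. c0 B - d B) T = avoid_sum n t' c0 T - avoid_sum n t' d T" for T
        unfolding avoid_sum_def sum_subtractf[symmetric] by (intro sum.cong) auto
      show ?thesis unfolding mins(1) unfolding 3(1)
      proof (rule avoid_sum_combine[of _ _ _ _ ?d "\<lambda>B. c0 B - d B"])
        show "2 * Suc t' \<le> Suc n" using True 3 by simp
        fix T assume "T \<in> ksubsets n (Suc t')"
        then have "f T = avoid_sum n t c0 T" using c0 3 by simp
        then show "f T = avoid_sum n (Suc t') ?d T + avoid_sum n t' (\<lambda>B. c0 B - d B) T"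
          unfolding 3(1)[symmetric] split top low diff by simp
      next
        fix T assume "T \<in> ksubsets n t'"
        then have "f1 T = ?top c0 T + avoid_sum n t' d T" using d by (simp add: algebra_simps)
        then show "f (insert (Suc n) T) = avoid_sum n (Suc t') ?d T"
          unfolding 3(1)[symmetric] split top low f1_def .
      qed
    next
      case False
      \<comment> \<open>Now \<open>f1\<close> is fitted first, with all of
        \<open>ballots n (Suc s)\<close>; the coefficients \<open>e\<close> then absorb what remains
        of \<open>f\<close>.\<close>
      define s where "s = n - t"
      have mins: "min t (Suc n - t) = Suc s" "min t (n - t) = s" and s: "2 * Suc s \<le> Suc n"
        using False 3 by (auto simp: s_def)
      have "ballots n (min t' (n - t')) = ballots n (Suc s)"
      proof (cases "2 * t = Suc n")
        case True
        then have "min t' (n - t') = s" "n < 2 * Suc s" using 3 by (auto simp: s_def)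
        then show ?thesis using ballots_eq_pred by simp
      next
        case False
        then have "min t' (n - t') = Suc s" using 3 \<open>\<not> 2 * t \<le> n\<close> by (auto simp: s_def)
        then show ?thesis by simp
      qed
      then obtain d where d: "\<And>T. T \<in> ksubsets n t' \<Longrightarrow> f1 T = avoid_sum n (Suc s) d T"
        using Suc.IH[of t' f1] 3 unfolding avoid_sum_def by auto
      obtain e where e: "\<And>T. T \<in> ksubsets n t \<Longrightarrow> f T - avoid_sum n (Suc s) d T = avoid_sum n s e T"
        using Suc.IH[of t "\<lambda>T. f T - avoid_sum n (Suc s) d T"] 3 mins by auto
      show ?thesis unfolding mins(1) unfolding 3(1)
      proof (rule avoid_sum_combine[OF s, of _ _ d e])
        show "f T = avoid_sum n (Suc s) d T + avoid_sum n s e T" if "T \<in> ksubsets n (Suc t')" for T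
          using e[of T] that 3 by (simp add: algebra_simps)
      qed (use d in \<open>simp add: f1_def\<close>)
    qed
  qed
qed

section \<open>Smith form and rank from an invertible block of columns\<close>

lemma inj_on_extend_permutes:
  fixes f :: "nat \<Rightarrow> nat"
  assumes inj: "inj_on f {..<m}" and im: "f ` {..<m} \<subseteq> {..<n}"
  obtains p where "p permutes {0..<n}" "\<And>i. i < m \<Longrightarrow> p i = f i"
proof -
  have mn: "m \<le> n" using card_mono[OF _ im] card_image[OF inj] by simp
  have "card ({..<n} - f ` {..<m}) = card {m..<n}"
    using im card_image[OF inj] by (subst card_Diff_subset) auto
  then obtain g where g: "bij_betw g {m..<n} ({..<n} - f ` {..<m})"
    using finite_same_card_bij[of "{m..<n}" "{..<n} - f ` {..<m}"] by auto
  define p where "p i = (if i < m then f i else if i < n then g i else i)" for i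
  have "bij_betw p {..<m} (f ` {..<m})"
    using inj by (auto simp: bij_betw_def p_def inj_on_def)
  moreover have "bij_betw p {m..<n} ({..<n} - f ` {..<m})"
    using g by (subst bij_betw_cong[of _ _ g]) (auto simp: p_def)
  ultimately have "bij_betw p ({..<m} \<union> {m..<n}) (f ` {..<m} \<union> ({..<n} - f ` {..<m}))"
    by (rule bij_betw_combine) auto
  moreover have "{..<m} \<union> {m..<n} = {0..<n}" using mn by auto
  moreover have "f ` {..<m} \<union> ({..<n} - f ` {..<m}) = {0..<n}" using im by auto
  ultimately have "bij_betw p {0..<n} {0..<n}" by simp
  then have "p permutes {0..<n}" using mn by (intro bij_imp_permutes) (auto simp: p_def)
  then show thesis by (rule that) (simp add: p_def)
qed

lemma exists_column_permutation:
  fixes A :: "int mat"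
  assumes A: "A \<in> carrier_mat m n" and p: "p permutes {0..<n}"
  obtains P where "P \<in> carrier_mat n n" "det P \<in> {1, - 1}"
    "A * P = mat m n (\<lambda>(i, j). A $$ (i, p j))"
proof
  \<comment> \<open>The identity with rows permuted has determinant \<open>signof p\<close>. Its
    transpose has its ones at \<open>(p j, j)\<close>, so right multiplication by it puts column
    \<open>p j\<close> in place \<open>j\<close>.\<close>
  let ?Q = "mat n n (\<lambda>(i, j). 1\<^sub>m n $$ (p i, j)) :: int mat"
  let ?P = "transpose_mat ?Q"
  show P: "?P \<in> carrier_mat n n" by simp
  have "det ?P = det ?Q" by (rule det_transpose[of _ n]) simp
  also have "\<dots> = signof p" using det_permute_rows[of "1\<^sub>m n :: int mat" n p] p by simp
  finally show "det ?P \<in> {1, - 1}" using signof_pm_one[of p] by metis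
  have pn: "p j < n" if "j < n" for j using permutes_in_image[OF p, of j] that by simp
  show "A * ?P = mat m n (\<lambda>(i, j). A $$ (i, p j))"
  proof (rule eq_matI)
    fix i j assume "i < dim_row (mat m n (\<lambda>(i, j). A $$ (i, p j)))" "j < dim_col (mat m n (\<lambda>(i, j). A $$ (i, p j)))"
    then have ij: "i < m" "j < n" by auto
    then have "(A * ?P) $$ (i, j) = (\<Sum>l = 0..<n. A $$ (i, l) * (if p j = l then 1 else 0))"
      using A pn[of j] by (auto simp: scalar_prod_def intro!: sum.cong)
    also have "\<dots> = A $$ (i, p j)" using pn[of j] ij by (simp add: if_distrib cong: if_cong)
    finally show "(A * ?P) $$ (i, j) = mat m n (\<lambda>(i, j). A $$ (i, p j)) $$ (i, j)" using ij by simp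
  qed (use A in auto)
qed

lemma det_pm1_if_mult_eq_1:
  fixes M R :: "int mat"
  assumes "M \<in> carrier_mat m m" "R \<in> carrier_mat m m" "M * R = 1\<^sub>m m"
  shows "det M \<in> {1, - 1}" "det R \<in> {1, - 1}"
proof -
  have "det M * det R = 1" using det_mult[OF assms(1,2)] assms(3) by simp
  then show "det M \<in> {1, - 1}" "det R \<in> {1, - 1}"
    using zmult_eq_1_iff by auto
qed

text \<open>After permuting the invertible columns to the front, \<open>(M | N)\<close> is reduced by
  \<open>(R, - R N; 0, 1)\<close>.\<close>
lemma smith_normal_form_if_invertible_columns:
  assumes A: "A \<in> carrier_mat m n"
    and inj: "inj_on f {..<m}" and im: "f ` {..<m} \<subseteq> {..<n}"
    and R: "R \<in> carrier_mat m m" and MR: "mat m m (\<lambda>(i, j). A $$ (i, f j)) * R = 1\<^sub>m m"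
  shows "is_smith_normal_form A (append_cols (1\<^sub>m m) (0\<^sub>m m (n - m)))"
proof -
  have mn: "m \<le> n" using card_mono[OF _ im] card_image[OF inj] by simp
  obtain p where p: "p permutes {0..<n}" "\<And>i. i < m \<Longrightarrow> p i = f i"
    using inj_on_extend_permutes[OF inj im] by blast
  obtain P where P: "P \<in> carrier_mat n n" "det P \<in> {1, - 1}"
    and AP: "A * P = mat m n (\<lambda>(i, j). A $$ (i, p j))"
    using exists_column_permutation[OF A p(1)] by blast
  define M where "M = mat m m (\<lambda>(i, j). A $$ (i, f j))"
  define N where "N = mat m (n - m) (\<lambda>(i, j). A $$ (i, p (j + m)))"
  define V where "V = four_block_mat R (- (R * N)) (0\<^sub>m (n - m) m) (1\<^sub>m (n - m))"
  have M: "M \<in> carrier_mat m m" and N: "N \<in> carrier_mat m (n - m)" by (simp_all add: M_def N_def)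
  have MR: "M * R = 1\<^sub>m m" using MR by (simp add: M_def)
  have RN: "R * N \<in> carrier_mat m (n - m)" using R N by simp
  have "V \<in> carrier_mat (m + (n - m)) (m + (n - m))" unfolding V_def
    by (intro four_block_carrier_mat R) simp
  then have V: "V \<in> carrier_mat n n" using mn by simp
  have "det V = det R" unfolding V_def
    using det_four_block_mat_lower_left_zero[OF R, of "- (R * N)" "n - m"] RN by simp
  then have detV: "det V \<in> {1, - 1}" using det_pm1_if_mult_eq_1[OF M R MR] by simp
  have "A * P = four_block_mat M N (0\<^sub>m 0 m) (0\<^sub>m 0 (n - m))"
    unfolding AP by (rule eq_matI) (use mn p(2) in \<open>auto simp: M_def N_def\<close>)
  then have "A * P * V = four_block_mat (M * R + N * 0\<^sub>m (n - m) m) (M * (- (R * N)) + N * 1\<^sub>m (n - m))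
      (0\<^sub>m 0 m * R + 0\<^sub>m 0 (n - m) * 0\<^sub>m (n - m) m) (0\<^sub>m 0 m * (- (R * N)) + 0\<^sub>m 0 (n - m) * 1\<^sub>m (n - m))"
    unfolding V_def using M N R RN by (simp only:) (rule mult_four_block_mat, auto)
  moreover have "M * R + N * 0\<^sub>m (n - m) m = 1\<^sub>m m" using MR N by simp
  moreover have "M * (- (R * N)) + N * 1\<^sub>m (n - m) = 0\<^sub>m m (n - m)"
  proof -
    have "M * (- (R * N)) = - (M * R * N)"
      using M R N RN assoc_mult_mat[OF M R N] by simp
    also have "\<dots> = - N" using MR N by simp
    finally show ?thesis using N by simp
  qed
  moreover have "0\<^sub>m 0 m * R + 0\<^sub>m 0 (n - m) * 0\<^sub>m (n - m) m = (0\<^sub>m 0 m :: int mat)"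
    using R by (intro eq_matI) auto
  moreover have "0\<^sub>m 0 m * (- (R * N)) + 0\<^sub>m 0 (n - m) * 1\<^sub>m (n - m) = (0\<^sub>m 0 (n - m) :: int mat)"
    using RN by (intro eq_matI) auto
  ultimately have APV: "A * P * V = append_cols (1\<^sub>m m) (0\<^sub>m m (n - m))"
    by (simp add: append_cols_def)
  then have eq: "1\<^sub>m m * A * (P * V) = append_cols (1\<^sub>m m) (0\<^sub>m m (n - m))"
    using A P V assoc_mult_mat[OF A P(1) V] by simp
  have "det (P * V) \<in> {1, - 1}" using det_mult[OF P(1) V] P(2) detV by auto
  then have "unimodular (P * V)" "unimodular (1\<^sub>m m)" using P V by (auto simp: unimodular_def)
  moreover have "append_cols (1\<^sub>m m) (0\<^sub>m m (n - m)) = append_cols (mat_diag m (\<lambda>_. 1 :: int)) (0\<^sub>m m (n - m))"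
    by simp
  ultimately show ?thesis
    unfolding is_smith_normal_form_def using eq A P V
    by (intro conjI exI[of _ m] exI[of _ "n - m"] exI[of _ "\<lambda>_. 1 :: int"] exI[of _ "1\<^sub>m m"] exI[of _ "P * V"])
      auto
qed

text \<open>A nonzero determinant makes the chosen columns distinct and independent, which bounds
  the rank below; the dimension of the ambient space bounds it above.\<close>

lemma (in vec_space) rank_eq_if_invertible_columns:
  assumes A: "A \<in> carrier_mat n nc" and im: "f ` {..<n} \<subseteq> {..<nc}"
    and det: "det (mat n n (\<lambda>(i, j). A $$ (i, f j))) \<noteq> 0"
  shows "rank A = n"
proof (rule antisym)
  let ?M = "mat n n (\<lambda>(i, j). A $$ (i, f j))"
  have M: "?M \<in> carrier_mat n n" by simp
  have rM: "rank ?M = n" using det_rank_iff[OF M] det by simp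
  then have dist: "distinct (cols ?M)" using non_distinct_low_rank[OF M] by auto
  have li: "lin_indpt (set (cols ?M))" by (rule full_rank_lin_indpt[OF M rM dist])
  have sub: "set (cols ?M) \<subseteq> set (cols A)"
  proof
    fix c assume "c \<in> set (cols ?M)"
    then obtain j where j: "j < n" "c = col ?M j" by (auto simp: cols_def)
    then have fj: "f j < nc" using im by auto
    have "c = col A (f j)" unfolding j(2) using j(1) fj A by (intro eq_vecI) auto
    then show "c \<in> set (cols A)" using fj A by (auto simp: cols_def)
  qed
  have "n = card (set (cols ?M))" using distinct_card[OF dist] by simp
  also have "\<dots> \<le> rank A" by (rule rank_ge_card_indpt[OF A sub li])
  finally show "n \<le> rank A" .
  \<comment> \<open>A maximal independent set of columns has \<open>rank A\<close> elements and,
    being independent in dimension \<open>n\<close>, at most \<open>n\<close>.\<close>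
  obtain S where S: "maximal S (\<lambda>T. T \<subseteq> set (cols A) \<and> lin_indpt T)" "finite S"
    using maximal_exists_superset[of "set (cols A)" "\<lambda>T. T \<subseteq> set (cols A) \<and> lin_indpt T" "set (cols ?M)"]
      sub li by auto
  have "S \<subseteq> carrier_vec n" "lin_indpt S" using S(1) cols_dim[of A] A by (auto simp: maximal_def)
  then have "card S \<le> n" using li_le_dim(2)[of S] dim_is_n by simp
  then show "rank A \<le> n" using rank_card_indpt[OF A S(1)] by simp
qed

section \<open>Inverting the diagonal matrix and counting intermediate sets\<close>

text \<open>The Gauss-Jordan computation is not unfolded: the reciprocal diagonal shows that the
  matrix is a unit, so \<open>mat_inverse\<close> cannot return \<open>None\<close>.\<close>

lemma mat_inverse_mat_diag:
  fixes d :: "nat \<Rightarrow> 'a::field"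
  assumes "\<And>i. i < n \<Longrightarrow> d i \<noteq> 0"
  obtains E where "mat_inverse (mat_diag n d) = Some E" "mat_diag n d * E = 1\<^sub>m n" "E \<in> carrier_mat n n"
proof -
  let ?D = "mat_diag n d" and ?E = "mat_diag n (\<lambda>i. inverse (d i))"
  have "mat_diag n (\<lambda>i. d i * inverse (d i)) = 1\<^sub>m n" "mat_diag n (\<lambda>i. inverse (d i) * d i) = 1\<^sub>m n"
    using assms by (auto simp: mat_diag_def intro!: eq_matI)
  then have "?D \<in> Units (ring_mat TYPE('a) n ())"
    unfolding Units_def by (auto simp: ring_mat_simps intro!: bexI[of _ ?E])
  then have "mat_inverse ?D \<noteq> None" using mat_inverse(1)[of ?D n "()"] by auto
  then obtain E where E: "mat_inverse ?D = Some E" by blast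
  show thesis using that[OF E] mat_inverse(2)[OF mat_diag_dim E] by blast
qed

lemma card_subsets_between:
  assumes "T \<subseteq> U" "finite U" "card T \<le> k"
  shows "card {K. T \<subseteq> K \<and> K \<subseteq> U \<and> card K = k} = (card U - card T) choose (k - card T)"
proof -
  have finT: "finite T" using assms finite_subset by auto
  have "bij_betw (\<lambda>K. K - T) {K. T \<subseteq> K \<and> K \<subseteq> U \<and> card K = k} {L. L \<subseteq> U - T \<and> card L = k - card T}"
  proof (rule bij_betwI[where g = "\<lambda>L. L \<union> T"])
    show "(\<lambda>K. K - T) \<in> {K. T \<subseteq> K \<and> K \<subseteq> U \<and> card K = k} \<rightarrow> {L. L \<subseteq> U - T \<and> card L = k - card T}"
      using finT by (auto simp: card_Diff_subset)
    show "(\<lambda>L. L \<union> T) \<in> {L. L \<subseteq> U - T \<and> card L = k - card T} \<rightarrow> {K. T \<subseteq> K \<and> K \<subseteq> U \<and> card K = k}"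
    proof
      fix L assume "L \<in> {L. L \<subseteq> U - T \<and> card L = k - card T}"
      then have L: "L \<subseteq> U - T" "card L = k - card T" by auto
      have "finite L" using L(1) assms(2) finite_subset by auto
      then have "card (L \<union> T) = card L + card T" using finT L(1) by (intro card_Un_disjoint) auto
      then show "L \<union> T \<in> {K. T \<subseteq> K \<and> K \<subseteq> U \<and> card K = k}" using L assms by auto
    qed
  qed auto
  then have "card {K. T \<subseteq> K \<and> K \<subseteq> U \<and> card K = k} = card {L. L \<subseteq> U - T \<and> card L = k - card T}"
    by (rule bij_betw_same_card)
  also have "\<dots> = (card U - card T) choose (k - card T)"
    using assms finT by (simp add: n_subsets card_Diff_subset)
  finally show ?thesis .
qed

lemma finite_ksubsets [simp]: "finite (ksubsets v k)"
  by (rule finite_subset[of _ "Pow {1..v}"]) (auto simp: ksubsets_def)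

lemma card_ksubsets: "card (ksubsets v k) = v choose k"
  using n_subsets[of "{1..v}" k] by (simp add: ksubsets_def)

text \<open>Gives \<open>k <= card (under v K)\<close> for a \<open>k\<close>-set \<open>K\<close>,
  hence nonzero diagonal entries in \<open>D_under_mat\<close>.\<close>

lemma subset_under:
  assumes "K \<subseteq> {1..v}"
  shows "K \<subseteq> under v K"
  using full_rank_part_subset[of "{1..v} - K"] assms by (auto simp: under_def)

text \<open>Identifies a column of \<open>W_under_mat\<close> with the avoidance vector of a
  full-rank part.\<close>

lemma subset_under_iff:
  "T \<subseteq> {1..v} \<Longrightarrow> T \<subseteq> under v K \<longleftrightarrow> T \<inter> full_rank_part ({1..v} - K) = {}"
  by (auto simp: under_def)

lemma sum_list_index:
  assumes "distinct xs"
  shows "(\<Sum>l = 0..<length xs. g (xs ! l)) = sum g (set xs)"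
  using assms by (simp add: sum_list_distinct_conv_sum_set[symmetric] sum_list_sum_nth)

lemma W_mat_mult_W_under_mat:
  assumes tk: "t \<le> k" and Ts: "set Ts = ksubsets v t" and Ks: "distinct Ks" "set Ks = ksubsets v k"
  shows "W_mat Ts Ks * W_under_mat v Ks Ks = (W_under_mat v Ts Ks * D_under_mat v t k Ks :: 'a::comm_ring_1 mat)"
proof (rule eq_matI)
  have D: "W_under_mat v Ts Ks * D_under_mat v t k Ks =
    (mat (length Ts) (length Ks) (\<lambda>(i, j). W_under_mat v Ts Ks $$ (i, j) *
       of_nat ((card (under v (Ks ! j)) - t) choose (k - t))) :: 'a mat)"
    unfolding D_under_mat_def by (rule mat_diag_mult_right) (simp add: W_under_mat_def)
  fix i j assume "i < dim_row (W_under_mat v Ts Ks * D_under_mat v t k Ks :: 'a mat)"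
    "j < dim_col (W_under_mat v Ts Ks * D_under_mat v t k Ks :: 'a mat)"
  then have ij: "i < length Ts" "j < length Ks" by (auto simp: W_under_mat_def D_under_mat_def mat_diag_def)
  let ?T = "Ts ! i" and ?U = "under v (Ks ! j)"
  have T: "card ?T = t" using nth_mem[OF ij(1)] Ts by (auto simp: ksubsets_def)
  have U: "?U \<subseteq> {1..v}" by (auto simp: under_def)
  have "(W_mat Ts Ks * W_under_mat v Ks Ks) $$ (i, j) =
     (\<Sum>l = 0..<length Ks. if ?T \<subseteq> Ks ! l \<and> Ks ! l \<subseteq> ?U then 1 else 0 :: 'a)"
    using ij by (auto simp: W_mat_def W_under_mat_def scalar_prod_def intro!: sum.cong)
  also have "\<dots> = (\<Sum>K\<in>ksubsets v k. if ?T \<subseteq> K \<and> K \<subseteq> ?U then 1 else 0)"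
    using sum_list_index[OF Ks(1), of "\<lambda>K. if ?T \<subseteq> K \<and> K \<subseteq> ?U then 1 else 0 :: 'a"] Ks(2) by simp
  also have "\<dots> = of_nat (card {K \<in> ksubsets v k. ?T \<subseteq> K \<and> K \<subseteq> ?U})"
    by (subst sum.inter_filter[symmetric]) simp_all
  also have "{K \<in> ksubsets v k. ?T \<subseteq> K \<and> K \<subseteq> ?U} = {K. ?T \<subseteq> K \<and> K \<subseteq> ?U \<and> card K = k}"
    using U by (auto simp: ksubsets_def)
  also have "of_nat (card \<dots>) = (W_under_mat v Ts Ks * D_under_mat v t k Ks :: 'a mat) $$ (i, j)"
  proof (cases "?T \<subseteq> ?U")
    case True
    have "finite ?U" using U finite_subset by auto
    from card_subsets_between[OF True this] T tk show ?thesis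
      unfolding D using ij True by (simp add: W_under_mat_def)
  next
    \<comment> \<open>Both sides vanish: no set lies between \<open>?T\<close> and
      \<open>?U\<close>, and the entry of \<open>W_under_mat\<close> is 0.\<close>
    case False
    then have none: "{K. ?T \<subseteq> K \<and> K \<subseteq> ?U \<and> card K = k} = {}" by auto
    show ?thesis unfolding D none using ij False by (simp add: W_under_mat_def)
  qed
  finally show "(W_mat Ts Ks * W_under_mat v Ks Ks) $$ (i, j) =
    (W_under_mat v Ts Ks * D_under_mat v t k Ks :: 'a mat) $$ (i, j)" .
qed (auto simp: W_mat_def W_under_mat_def D_under_mat_def mat_diag_def)

section \<open>The unimodular block and the final assembly\<close>

text \<open>One column is chosen for each ballot set, and there are as many of these as rows.
  Expanding each unit vector in avoidance vectors yields the columns of an integral right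
  inverse.\<close>

lemma W_under_mat_invertible_columns:
  assumes tk: "t \<le> k" "t + k \<le> v" and Ts: "distinct Ts" "set Ts = ksubsets v t"
    and Ks: "set Ks = ksubsets v k" and m: "m = v choose t"
  obtains f and R :: "int mat" where "inj_on f {..<m}" "f ` {..<m} \<subseteq> {..<length Ks}" "R \<in> carrier_mat m m"
    "mat m m (\<lambda>(i, j). W_under_mat v Ts Ks $$ (i, f j)) * R = 1\<^sub>m m"
proof -
  obtain Bs where Bs: "set Bs = ballots v t" "distinct Bs"
    using finite_distinct_list[OF finite_ballots] by blast
  have lB: "length Bs = m"
    using distinct_card[OF Bs(2)] Bs(1) card_ballots[of t v] tk m by simp
  have lT: "length Ts = m" using distinct_card[OF Ts(1)] Ts(2) card_ksubsets m by simp
  have "\<exists>i<length Ks. full_rank_part ({1..v} - Ks ! i) = Bs ! j" if "j < m" for j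
  proof -
    have "Bs ! j \<in> ballots v t" using nth_mem[of j Bs] that lB Bs(1) by simp
    then obtain K where "K \<in> set Ks" "full_rank_part ({1..v} - K) = Bs ! j"
      using exists_under_eq[OF _ tk] Ks by metis
    then show ?thesis by (metis in_set_conv_nth)
  qed
  then obtain f where f: "\<And>j. j < m \<Longrightarrow> f j < length Ks \<and> full_rank_part ({1..v} - Ks ! f j) = Bs ! j"
    by metis
  have inj: "inj_on f {..<m}"
  proof (rule inj_onI)
    fix x y assume "x \<in> {..<m}" "y \<in> {..<m}" "f x = f y"
    then have "Bs ! x = Bs ! y" "x < length Bs" "y < length Bs" using f lB by (metis lessThan_iff)+
    then show "x = y" using Bs(2) by (simp add: nth_eq_iff_index_eq)
  qed
  \<comment> \<open>From \<open>t <= k\<close> and \<open>t + k <= v\<close>, so the spanning result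
    concerns exactly the ballot sets listed in \<open>Bs\<close>.\<close>
  have mt: "min t (v - t) = t" using tk by simp
  have "\<exists>c. \<forall>T\<in>ksubsets v t. (if T = Ts ! j then 1 else 0 :: int) = avoid_sum v t c T" for j
    using avoid_sum_spans[of t v "\<lambda>T. if T = Ts ! j then 1 else 0 :: int"] tk unfolding mt by simp
  then obtain c where c: "\<And>j T. T \<in> ksubsets v t \<Longrightarrow> avoid_sum v t (c j) T = (if T = Ts ! j then 1 else 0 :: int)"
    by metis
  define R where "R = mat m m (\<lambda>(b, j). c j (Bs ! b))"
  let ?M = "mat m m (\<lambda>(i, j). W_under_mat v Ts Ks $$ (i, f j)) :: int mat"
  have "?M * R = 1\<^sub>m m"
  proof (rule eq_matI)
    fix i j assume "i < dim_row (1\<^sub>m m :: int mat)" "j < dim_col (1\<^sub>m m :: int mat)"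
    then have ij: "i < m" "j < m" by auto
    have Ti: "Ts ! i \<in> ksubsets v t" using nth_mem[of i Ts] ij lT Ts(2) by simp
    then have Tv: "Ts ! i \<subseteq> {1..v}" by (simp add: ksubsets_def)
    have "(?M * R) $$ (i, j) = (\<Sum>b = 0..<length Bs. if Ts ! i \<inter> Bs ! b = {} then c j (Bs ! b) else 0)"
      using ij lB lT f subset_under_iff[OF Tv]
      by (auto simp: scalar_prod_def R_def W_under_mat_def intro!: sum.cong)
    also have "\<dots> = avoid_sum v t (c j) (Ts ! i)"
      unfolding avoid_sum_def Bs(1)[symmetric]
      by (rule sum_list_index[OF Bs(2), of "\<lambda>B. if Ts ! i \<inter> B = {} then c j B else 0"])
    also have "\<dots> = 1\<^sub>m m $$ (i, j)"
      using c[OF Ti] ij Ts(1) lT by (simp add: nth_eq_iff_index_eq)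
    finally show "(?M * R) $$ (i, j) = 1\<^sub>m m $$ (i, j)" .
  qed (simp_all add: R_def)
  moreover have "R \<in> carrier_mat m m" by (simp add: R_def)
  moreover have "f ` {..<m} \<subseteq> {..<length Ks}" using f by auto
  ultimately show thesis using inj that by blast
qed

theorem theorem5p1:
  fixes t k v :: nat and Ts Ks :: "nat set list"
  assumes "t \<le> k" and "t + k \<le> v"
    and "distinct Ts" and "set Ts = ksubsets v t"
    and "distinct Ks" and "set Ks = ksubsets v k"
  shows
    "is_smith_normal_form (W_under_mat v Ts Ks)
       (append_cols (1\<^sub>m (v choose t)) (0\<^sub>m (v choose t) ((v choose k) - (v choose t)))) \<and>
     vec_space.rank (v choose t)
       (map_mat of_int (W_under_mat v Ts Ks) :: 'p::prime_card mod_ring mat) = v choose t \<and>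
     (\<exists>D_inv :: real mat. mat_inverse (D_under_mat v t k Ks) = Some D_inv \<and>
       (\<forall>(l :: nat) (x :: real vec). 0 < l \<longrightarrow> x \<in> carrier_vec (length Ks) \<longrightarrow>
         (W_under_mat v Ts Ks *\<^sub>v x = of_nat l \<cdot>\<^sub>v vec (length Ts) (\<lambda>_. 1) \<longleftrightarrow>
          (let y = W_under_mat v Ks Ks * D_inv *\<^sub>v x
           in W_mat Ts Ks *\<^sub>v y = of_nat l \<cdot>\<^sub>v vec (length Ts) (\<lambda>_. 1)))))"
proof -
  let ?m = "v choose t" and ?n = "length Ks"
  have n: "?n = v choose k" using distinct_card[OF assms(5)] assms(6) card_ksubsets by simp
  have lT: "length Ts = ?m" using distinct_card[OF assms(3)] assms(4) card_ksubsets by simp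
  have W: "(W_under_mat v Ts Ks :: int mat) \<in> carrier_mat ?m ?n" by (simp add: W_under_mat_def lT)
  obtain f and R :: "int mat" where inj: "inj_on f {..<?m}" and im: "f ` {..<?m} \<subseteq> {..<?n}"
    and R: "R \<in> carrier_mat ?m ?m"
    and MR: "mat ?m ?m (\<lambda>(i, j). W_under_mat v Ts Ks $$ (i, f j)) * R = 1\<^sub>m ?m"
    using W_under_mat_invertible_columns[OF assms(1-4,6) refl] by blast
  let ?M = "mat ?m ?m (\<lambda>(i, j). W_under_mat v Ts Ks $$ (i, f j)) :: int mat"
  have snf: "is_smith_normal_form (W_under_mat v Ts Ks) (append_cols (1\<^sub>m ?m) (0\<^sub>m ?m ((v choose k) - ?m)))"
    using smith_normal_form_if_invertible_columns[OF W inj im R MR] unfolding n .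
  have rank: "vec_space.rank ?m (map_mat of_int (W_under_mat v Ts Ks) :: 'p mod_ring mat) = ?m"
  proof (rule vec_space.rank_eq_if_invertible_columns[OF _ im])
    \<comment> \<open>A determinant of 1 or -1 stays nonzero modulo every prime.\<close>
    have "det ?M \<in> {1, - 1}" using det_pm1_if_mult_eq_1(1)[OF _ R MR] by simp
    then have "of_int (det ?M) \<noteq> (0 :: 'p mod_ring)" by auto
    then have "det (map_mat of_int ?M) \<noteq> (0 :: 'p mod_ring)" by (simp add: of_int_hom.hom_det)
    also have "map_mat of_int ?M = mat ?m ?m (\<lambda>(i, j). map_mat of_int (W_under_mat v Ts Ks) $$ (i, f j) :: 'p mod_ring)"
    proof (rule eq_matI)
      fix i j assume "i < dim_row (mat ?m ?m (\<lambda>(i, j). map_mat of_int (W_under_mat v Ts Ks) $$ (i, f j) :: 'p mod_ring))"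
        "j < dim_col (mat ?m ?m (\<lambda>(i, j). map_mat of_int (W_under_mat v Ts Ks) $$ (i, f j) :: 'p mod_ring))"
      then have ij: "i < ?m" "j < ?m" by simp_all
      then have "f j < ?n" using im by auto
      then have "map_mat of_int (W_under_mat v Ts Ks) $$ (i, f j) = (of_int (W_under_mat v Ts Ks $$ (i, f j)) :: 'p mod_ring)"
        using ij W by (intro index_map_mat) auto
      then show "map_mat of_int ?M $$ (i, j) =
          mat ?m ?m (\<lambda>(i, j). map_mat of_int (W_under_mat v Ts Ks) $$ (i, f j) :: 'p mod_ring) $$ (i, j)"
        using ij by simp
    qed simp_all
    finally show "det (mat ?m ?m (\<lambda>(i, j). map_mat of_int (W_under_mat v Ts Ks) $$ (i, f j) :: 'p mod_ring)) \<noteq> 0" .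
  qed (use W in simp)
  have d: "(card (under v (Ks ! j)) - t) choose (k - t) \<noteq> 0" if "j < ?n" for j
  proof -
    have K: "Ks ! j \<subseteq> {1..v}" "card (Ks ! j) = k" using nth_mem[OF that] assms(6) by (auto simp: ksubsets_def)
    have "finite (under v (Ks ! j))" by (simp add: under_def)
    then have "k \<le> card (under v (Ks ! j))" using card_mono[OF _ subset_under[OF K(1)]] K(2) by simp
    then show ?thesis using zero_less_binomial[of "k - t" "card (under v (Ks ! j)) - t"] by simp
  qed
  let ?d = "\<lambda>j. of_nat ((card (under v (Ks ! j)) - t) choose (k - t)) :: real"
  have "?d j \<noteq> 0" if "j < ?n" for j using d[OF that] unfolding of_nat_eq_0_iff .
  from mat_inverse_mat_diag[of ?n ?d, OF this]
  obtain E :: "real mat" where E: "mat_inverse (D_under_mat v t k Ks) = Some E"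
    "D_under_mat v t k Ks * E = 1\<^sub>m ?n" "E \<in> carrier_mat ?n ?n"
    unfolding D_under_mat_def by blast
  have A: "(W_mat Ts Ks :: real mat) \<in> carrier_mat ?m ?n"
    and B: "(W_under_mat v Ks Ks :: real mat) \<in> carrier_mat ?n ?n"
    and C: "(W_under_mat v Ts Ks :: real mat) \<in> carrier_mat ?m ?n"
    and D: "(D_under_mat v t k Ks :: real mat) \<in> carrier_mat ?n ?n"
    by (simp_all add: W_mat_def W_under_mat_def D_under_mat_def lT)
  \<comment> \<open>The two equations of the equivalence have the same left-hand side: cancelling
    \<open>D_under_mat\<close> against \<open>E\<close> in the product identity turns one into the
    other.\<close>
  have "W_mat Ts Ks *\<^sub>v (W_under_mat v Ks Ks * E *\<^sub>v x) = W_under_mat v Ts Ks *\<^sub>v x"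
    if x: "x \<in> carrier_vec ?n" for x :: "real vec"
  proof -
    have "W_mat Ts Ks *\<^sub>v (W_under_mat v Ks Ks * E *\<^sub>v x) = (W_mat Ts Ks * (W_under_mat v Ks Ks * E)) *\<^sub>v x"
      by (rule assoc_mult_mat_vec[OF A mult_carrier_mat[OF B E(3)] x, symmetric])
    also have "W_mat Ts Ks * (W_under_mat v Ks Ks * E) = W_mat Ts Ks * W_under_mat v Ks Ks * E"
      by (rule assoc_mult_mat[OF A B E(3), symmetric])
    also have "\<dots> = W_under_mat v Ts Ks * (D_under_mat v t k Ks * E)"
      unfolding W_mat_mult_W_under_mat[OF assms(1,4,5,6)] by (rule assoc_mult_mat[OF C D E(3)])
    also have "\<dots> = W_under_mat v Ts Ks" using E(2) right_mult_one_mat[OF C] by simp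
    finally show ?thesis .
  qed
  then show ?thesis using snf rank E(1) by (intro conjI exI[of _ E]) (simp_all add: Let_def)
qed

end
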